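(* Let $P(x)\subseteq[0,1]^{d_x}$ be a $0$-$1$ polytope. For every polytope $Q(x,y)=\{(x,y)\in\mathbb{R}^{d_x}\times\mathbb{R}^{d_y}\mid Ax+By\le b\}$ such that $P(x)\subseteq \operatorname{proj}_x(Q(x,y))$, there is a translation $T[Q(x,y)]$ of $Q$ to product relaxations (that is, a substitution $T$ such that $T[Q(x,y)]$ is a product relaxation of $P(x)$) such that $$P(x)\subseteq \operatorname{proj}_x(T[Q(x,y)])\subseteq \operatorname{proj}_x(Q(x,y)).$$
   Context: A $0$-$1$ polytope $P(x)\subseteq[0,1]^{d}$ is the convex hull of a set of $0$-$1$ vectors. For a polyhedron $K(x,y)$, $\operatorname{proj}_x(K)=\{x\mid \exists y:\ (x,y)\in K\}$. An extended relaxation of $P(x)$ is a linear system (polyhedron) $K(x,y)$ with $\operatorname{proj}_x(K)\supseteq P(x)$. Product relaxation: Given a $0$-$1$ polytope $P(x)\subseteq[0,1]^{d}$, a product relaxation $D(z)$ of $P(x)$ is an extended relaxation of $P(x)$ in variables $z\in\mathbb{R}^{2^d-1}$, with one variable $z_{\mathcal E}$ for every nonempty subset $\mathcal E\subseteq\{x_1,\dots,x_d\}$, where $z_{\{x_i\}}$ is identified with the original variable $x_i$, and such that for every $x\in P(x)\cap\{0,1\}^d$ the vector $f(x)$ with coordinates $f_{\mathcal E}(x)=\prod_{x_i\in\mathcal E}x_i$ belongs to $D(z)$. The function $f$ is called the product section. The projection $\operatorname{proj}_x$ of a product relaxation is the projection onto the coordinates $z_{\{x_i\}}=x_i$. Substitution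 and translation: A substitution $T$ expresses each $y_i$, $i=1,\dots,d_y$, as an affine function of the product variables, $y=T(z,1)$, where $T$ is a $d_y\times 2^{d_x}$ real matrix, $z\in\mathbb{R}^{2^{d_x}-1}$ and $(z,1)$ is $z$ with the scalar $1$ appended. $T[Q(x,y)]$ is the linear system in the variables $z$ obtained from the system $Ax+By\le b$ by substituting for each $y_i$ the $i$-th such affine expression and for each $x_i$ the variable $z_{\{x_i\}}$. It has the same number of inequalities as the system defining $Q$. If $T[Q(x,y)]$ is a product relaxation of $P(x)$ it is called a translation of $Q$ to product relaxations. *)

theory Defs
  imports "HOL-Analysis.Analysis"
begin

definition zero_one_vec :: "real ^ 'n \<Rightarrow> bool" where
  "zero_one_vec x \<longleftrightarrow> (\<forall>i. x $ i = 0 \<or> x $ i = 1)"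

definition zero_one_polytope :: "(real ^ 'n) set \<Rightarrow> bool" where
  "zero_one_polytope P \<longleftrightarrow> (\<exists>V. (\<forall>v\<in>V. zero_one_vec v) \<and> P = convex hull V)"

definition proj_x :: "('a \<times> 'b) set \<Rightarrow> 'a set" where
  "proj_x K = {x. \<exists>y. (x, y) \<in> K}"

definition ineq_system ::
  "real ^ 'n ^ 'r \<Rightarrow> real ^ 'm ^ 'r \<Rightarrow> real ^ 'r \<Rightarrow> ((real ^ 'n) \<times> (real ^ 'm)) set" where
  "ineq_system A B b = {(x, y). \<forall>r. (A *v x + B *v y) $ r \<le> b $ r}"

text \<open>Index type of the product variables \<open>z\<^sub>E\<close>; the original
  variable \<open>x\<^sub>i\<close> is identified with its index \<open>i :: 'n\<close>.\<close>

typedef 'n nonempty_subset = "{E :: 'n set. E \<noteq> {}}"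
  morphisms elems Nonempty_subset
  by auto

instance nonempty_subset :: (finite) finite
proof
  have "inj (elems :: 'a nonempty_subset \<Rightarrow> 'a set)"
    by (rule injI) (simp add: elems_inject)
  then show "finite (UNIV :: 'a nonempty_subset set)"
    by (rule finite_imageD[rotated]) simp
qed

lemma card_nonempty_subset: "CARD('n::finite nonempty_subset) = 2 ^ CARD('n) - 1"
proof -
  have "CARD('n nonempty_subset) = card {E :: 'n set. E \<noteq> {}}"
    by (rule type_definition.card[OF type_definition_nonempty_subset])
  also have "{E :: 'n set. E \<noteq> {}} = Pow UNIV - {{}}"
    by auto
  also have "card \<dots> = 2 ^ CARD('n) - 1"
    by (simp add: card_Diff_singleton card_Pow del: Pow_UNIV)
  finally show ?thesis .
qed

definition orig_part :: "real ^ ('n::finite nonempty_subset) \<Rightarrow> real ^ 'n" where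
  "orig_part z = (\<chi> i. z $ Nonempty_subset {i})"

definition proj_orig :: "(real ^ ('n::finite nonempty_subset)) set \<Rightarrow> (real ^ 'n) set" where
  "proj_orig D = {x. \<exists>z\<in>D. orig_part z = x}"

definition product_section :: "real ^ 'n::finite \<Rightarrow> real ^ ('n nonempty_subset)" where
  "product_section x = (\<chi> E. \<Prod>i\<in>elems E. x $ i)"

definition product_relaxation ::
  "(real ^ 'n) set \<Rightarrow> (real ^ ('n::finite nonempty_subset)) set \<Rightarrow> bool" where
  "product_relaxation P D \<longleftrightarrow>
     polyhedron D \<and> P \<subseteq> proj_orig D \<and>
     (\<forall>x\<in>P. zero_one_vec x \<longrightarrow> product_section x \<in> D)"

text \<open>The vector \<open>(z, 1)\<close>: coordinate \<open>None\<close> carries the appended scalar, so that a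
  substitution is a matrix with \<open>2 ^ CARD('n)\<close> columns.\<close>

definition append_one ::
  "real ^ ('n::finite nonempty_subset) \<Rightarrow> real ^ ('n nonempty_subset option)" where
  "append_one z = (\<chi> k. case k of None \<Rightarrow> 1 | Some E \<Rightarrow> z $ E)"

definition subst_system ::
  "real ^ ('n::finite nonempty_subset option) ^ 'm \<Rightarrow>
   real ^ 'n ^ 'r \<Rightarrow> real ^ 'm ^ 'r \<Rightarrow> real ^ 'r \<Rightarrow> (real ^ ('n::finite nonempty_subset)) set" where
  "subst_system T A B b =
     {z. \<forall>r. (A *v orig_part z + B *v (T *v append_one z)) $ r \<le> b $ r}"

end

theory Submission imports Defs begin

text \<open>
  By Moebius inversion on the Boolean lattice, every function on the 0-1 vectors is a multilinear
  polynomial, that is, an affine function of the product section. Choosing for each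
  0-1 vector \<open>x\<close> of \<open>P\<close> a point \<open>(x, y)\<close> of \<open>Q\<close>, some substitution \<open>T\<close>
  therefore sends \<open>f x\<close> to the chosen \<open>y\<close>, so that \<open>f x\<close> satisfies the
  translated system. The inclusion of \<open>P\<close> follows by convexity, and
  \<open>z \<mapsto> (x, T (z, 1))\<close> maps the translated system into \<open>Q\<close>.
\<close>

text \<open>Columns of a substitution are indexed by an option type. Reading \<open>None\<close> as
  the empty set, whose empty product is the appended scalar 1, makes them range over all squarefree
  monomials.\<close>

definition option_elems :: "'n nonempty_subset option \<Rightarrow> 'n set" where
  "option_elems k = (case k of None \<Rightarrow> {} | Some E \<Rightarrow> elems E)"

lemma bij_option_elems: "bij option_elems"
proof (rule bijI)
  have "elems E \<noteq> {}" for E :: "'n nonempty_subset"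
    using elems by blast
  then show "inj (option_elems :: 'n nonempty_subset option \<Rightarrow> _)"
    by (auto simp: inj_def option_elems_def elems_inject split: option.splits)
  show "surj (option_elems :: 'n nonempty_subset option \<Rightarrow> _)"
  proof (rule surjI)
    fix S :: "'n set"
    show "option_elems (if S = {} then None else Some (Nonempty_subset S)) = S"
      by (simp add: option_elems_def Nonempty_subset_inverse)
  qed
qed

lemma append_one_product_section:
  "append_one (product_section x) $ k = (\<Prod>i\<in>option_elems k. x $ i)"
  by (simp add: append_one_def product_section_def option_elems_def split: option.split)

lemma prod_zero_one_vec:
  fixes x :: "real ^ 'n"
  assumes "zero_one_vec x"
  shows "(\<Prod>i\<in>S. x $ i) = (if S \<subseteq> {i. x $ i = 1} then 1 else 0)"
proof (cases "S \<subseteq> {i. x $ i = 1}")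
  case True
  then show ?thesis by (auto intro!: prod.neutral)
next
  case False
  then obtain i where "i \<in> S" "x $ i = 0"
    using assms by (auto simp: zero_one_vec_def)
  then show ?thesis using False by (auto intro: prod_zero)
qed

lemma exists_subset_sum_representation:
  fixes g :: "'a set \<Rightarrow> real"
  shows "\<exists>c. \<forall>S. finite S \<longrightarrow> g S = (\<Sum>E\<in>Pow S. c E)"
proof -
  \<comment> \<open>The signed subset-sum transform is an involution on finite sets, so applying it
    to \<open>h\<close> recovers \<open>g\<close>; the coefficients sought are the signed values of
    \<open>h\<close>.\<close>
  define h where "h S = (\<Sum>E\<in>Pow S. (-1) ^ card E * g E)" for S
  have "g S = (\<Sum>E\<in>Pow S. (-1) ^ card E * h E)" if "finite S" for S
    using that by (rule inclusion_exclusion_symmetric[rotated]) (simp add: h_def)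
  then show ?thesis
    by (intro exI[of _ "\<lambda>E. (-1) ^ card E * h E"]) blast
qed

text \<open>At a 0-1 vector with support S, a multilinear polynomial equals the sum of its
  coefficients over the subsets of S. Moebius inversion, done separately for each coordinate of
  \<open>y\<close>, therefore yields the rows of \<open>T\<close>.\<close>

lemma exists_interpolating_substitution:
  fixes y :: "real ^ 'n::finite \<Rightarrow> real ^ 'm"
  shows "\<exists>T :: real ^ ('n nonempty_subset option) ^ 'm.
    \<forall>x. zero_one_vec x \<longrightarrow> T *v append_one (product_section x) = y x"
proof -
  have "\<exists>c. \<forall>S. y (\<chi> i. if i \<in> S then 1 else 0) $ j = (\<Sum>E\<in>Pow S. c E)" for j
    using exists_subset_sum_representation
      [of "\<lambda>S. y (\<chi> i. if i \<in> S then 1 else 0) $ j"] by simp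
  then obtain c where c:
    "\<And>j S. y (\<chi> i. if i \<in> S then 1 else 0) $ j = (\<Sum>E\<in>Pow S. c j E)"
    by metis
  define T :: "real ^ ('n nonempty_subset option) ^ 'm"
    where "T = (\<chi> j k. c j (option_elems k))"
  have "(T *v append_one (product_section x)) $ j = y x $ j" if x: "zero_one_vec x" for x j
  proof -
    let ?S = "{i. x $ i = 1}"
    have ind: "(\<chi> i. if i \<in> ?S then 1 else 0) = x"
      using x by (auto simp: vec_eq_iff zero_one_vec_def)
    have "(T *v append_one (product_section x)) $ j =
        (\<Sum>k\<in>UNIV. c j (option_elems k) * (\<Prod>i\<in>option_elems k. x $ i))"
      by (simp add: T_def matrix_vector_mult_def append_one_product_section)
    also have "\<dots> = (\<Sum>E\<in>UNIV. c j E * (\<Prod>i\<in>E. x $ i))"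
      using bij_option_elems
      by (rule sum.reindex_bij_betw[of option_elems UNIV UNIV "\<lambda>E. c j E * (\<Prod>i\<in>E. x $ i)"])
    \<comment> \<open>Monomials not contained in the support of \<open>x\<close> vanish, the others
      equal 1.\<close>
    also have "\<dots> = (\<Sum>E\<in>Pow ?S. c j E)"
      unfolding prod_zero_one_vec[OF x]
      by (intro sum.mono_neutral_cong_right) auto
    also have "\<dots> = y x $ j"
      using c[of ?S j] unfolding ind by simp
    finally show ?thesis .
  qed
  then show ?thesis by (auto simp: vec_eq_iff)
qed

lemma linear_orig_part: "linear orig_part"
  by (rule linearI) (simp_all add: orig_part_def vec_eq_iff)

lemma orig_part_product_section: "orig_part (product_section x) = x"
  by (simp add: orig_part_def product_section_def Nonempty_subset_inverse vec_eq_iff)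

text \<open>\<open>append_one\<close> is only affine; subtracting its value at 0 isolates the linear
  part.\<close>

lemma linear_append_one_diff: "linear (\<lambda>z. append_one z - append_one 0)"
  by (rule linearI)
    (auto simp: append_one_def vec_eq_iff split: option.splits)

lemma polyhedron_subst_system: "polyhedron (subst_system T A B b)"
proof -
  define L where "L z = A *v orig_part z + B *v (T *v (append_one z - append_one 0))" for z
  define d where "d = B *v (T *v append_one 0)"
  have "linear L"
    unfolding L_def
    by (intro linear_compose_add
        linear_compose[OF linear_orig_part matrix_vector_mul_linear, unfolded o_def]
        linear_compose[OF linear_compose[OF linear_append_one_diff matrix_vector_mul_linear]
          matrix_vector_mul_linear, unfolded o_def])
  have eq: "A *v orig_part z + B *v (T *v append_one z) = L z + d" for z
    by (simp add: L_def d_def matrix_vector_mult_diff_distrib)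
  \<comment> \<open>The adjoint supplies the normal vector of the half-space given by row
    \<open>r\<close>.\<close>
  have row: "L z $ r = adjoint L (axis r 1) \<bullet> z" for z r
    by (metis adjoint_works[OF \<open>linear L\<close>] cart_eq_inner_axis inner_commute)
  have "subst_system T A B b = (\<Inter>r. {z. adjoint L (axis r 1) \<bullet> z \<le> b $ r - d $ r})"
    by (auto simp: subst_system_def eq simp flip: row simp: le_diff_eq)
  then show ?thesis
    by (auto intro!: polyhedron_Inter polyhedron_halfspace_le)
qed

theorem theorem3p1:
  fixes P :: "(real ^ 'n::finite) set"
    and A :: "real ^ 'n ^ 'r" and B :: "real ^ 'm ^ 'r" and b :: "real ^ 'r"
  assumes "zero_one_polytope P"
    and "polytope (ineq_system A B b)"
    and "P \<subseteq> proj_x (ineq_system A B b)"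
  shows "\<exists>T :: real ^ ('n nonempty_subset option) ^ 'm.
           product_relaxation P (subst_system T A B b) \<and>
           P \<subseteq> proj_orig (subst_system T A B b) \<and>
           proj_orig (subst_system T A B b) \<subseteq> proj_x (ineq_system A B b)"
proof -
  obtain V where V: "\<forall>v\<in>V. zero_one_vec v" "P = convex hull V"
    using assms(1) by (auto simp: zero_one_polytope_def)
  \<comment> \<open>Outside \<open>P\<close> the values of \<open>y\<close> are arbitrary:
    interpolation there is harmless.\<close>
  obtain y where y: "\<And>x. x \<in> P \<Longrightarrow> (x, y x) \<in> ineq_system A B b"
    using assms(3) unfolding proj_x_def by (auto simp: subset_iff) metis
  obtain T :: "real ^ ('n nonempty_subset option) ^ 'm"
    where T: "\<And>x. zero_one_vec x \<Longrightarrow> T *v append_one (product_section x) = y x"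
    using exists_interpolating_substitution[of y] by blast
  let ?D = "subst_system T A B b"
  have section_in: "product_section x \<in> ?D" if "x \<in> P" "zero_one_vec x" for x
    using y[OF that(1)] T[OF that(2)]
    by (simp add: subst_system_def ineq_system_def orig_part_product_section)
  have proj: "proj_orig ?D = orig_part ` ?D"
    by (auto simp: proj_orig_def)
  have "V \<subseteq> proj_orig ?D"
  proof
    fix v assume "v \<in> V"
    then have "product_section v \<in> ?D"
      using V hull_inc[of v V convex] by (auto intro: section_in)
    then show "v \<in> proj_orig ?D"
      by (auto simp: proj_orig_def intro: orig_part_product_section)
  qed
  moreover have "convex (proj_orig ?D)"
    unfolding proj
    by (intro convex_linear_image linear_orig_part polyhedron_imp_convex polyhedron_subst_system)
  ultimately have "P \<subseteq> proj_orig ?D"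
    unfolding V(2) by (rule hull_minimal)
  \<comment> \<open>The witness for the second component is
    \<open>T *v append_one z\<close>.\<close>
  moreover have "proj_orig ?D \<subseteq> proj_x (ineq_system A B b)"
    by (auto simp: proj_orig_def proj_x_def subst_system_def ineq_system_def)
  ultimately show ?thesis
    using section_in polyhedron_subst_system unfolding product_relaxation_def by blast
qed

end
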